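(* Let $n\ge1$, and consider a shortened polar code obtained from the polar code of length $2^n$, with index set $\mathcal{U}_s\subseteq\mathbb{Z}_{2^n}$ of shortened encoder input bits and index set $\mathcal{X}_s\subseteq\mathbb{Z}_{2^n}$ of the corresponding fixed encoder output bits. Let $j\in\mathbb{Z}_{2^n}\setminus\mathcal{X}_s$. The encoder output bit $x_j$ can be fixed to zero by additionally shortening a single encoder input bit (that is, there exists $k\in\mathbb{Z}_{2^n}\setminus\mathcal{U}_s$ such that $x_j$ is fixed when the input bits with indices in $\mathcal{U}_s\cup\{k\}$ are shortened) if and only if $\hat{\mathcal{G}}_j\subseteq\mathcal{X}_s$.
   Context: Let $\mathbb{Z}_{2^n}=\{0,1,\ldots,2^n-1\}$ and write $i=\sum_{t=0}^{n-1}i_t2^t$ with $i_t\in\{0,1\}$. Binary domination: $i\preceq j$ iff $i_t\le j_t$ for all $t$; $k\succ j$ iff $j\preceq k$ and $j\ne k$. $\hat{\mathcal{G}}_j=\{k\in\mathbb{Z}_{2^n}:k\succ j\}$. The polar code of length $2^n$ encodes $\mathbf{u}\in\mathbb{F}_2^{2^n}$ to $\mathbf{x}=\mathbf{u}\left[\begin{smallmatrix}1&0\\1&1\end{smallmatrix}\right]^{\otimes n}$ (rows and columns indexed by $\mathbb{Z}_{2^n}$ in the natural order). Shortening the input bits with indices in a set $\mathcal{S}$ means setting $u_i=0$ for all $i\in\mathcal{S}$. The output bit $x_j$ is then fixed (to zero) if $x_j=0$ for every $\mathbf{u}\in\mathbb{F}_2^{2^n}$ with $u_i=0$ for all $i\in\mathcal{S}$;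 $\mathcal{X}_s$ is the set of all $j$ such that $x_j$ is fixed when $\mathcal{S}=\mathcal{U}_s$. In a shortened polar code, the $J$ shortened input bits are chosen so that exactly $J$ output bits are fixed, i.e. $|\mathcal{X}_s|=|\mathcal{U}_s|$. *)

theory Defs
  imports "HOL-Library.Z2" "Jordan_Normal_Form.Matrix"
begin

definition kronecker :: "'a::times mat \<Rightarrow> 'a mat \<Rightarrow> 'a mat" where
  "kronecker A B = mat (dim_row A * dim_row B) (dim_col A * dim_col B)
     (\<lambda>(i, j). A $$ (i div dim_row B, j div dim_col B) * B $$ (i mod dim_row B, j mod dim_col B))"

primrec kronecker_power :: "'a::semiring_1 mat \<Rightarrow> nat \<Rightarrow> 'a mat" where
  "kronecker_power A 0 = 1\<^sub>m 1"
| "kronecker_power A (Suc n) = kronecker A (kronecker_power A n)"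

text \<open>The type \<^typ>\<open>bit\<close> is the field with two elements; the term constant \<^const>\<open>bit\<close>,
  used further below, is the unrelated binary-digit predicate of the library.\<close>

definition polar_kernel :: "bit mat" where
  "polar_kernel = mat_of_rows_list 2 [[1, 0], [1, 1]]"

text \<open>The product of the row vector \<open>u\<close> with a matrix on its right is expressed as the
  transposed matrix applied to \<open>u\<close>.\<close>

definition polar_encode :: "nat \<Rightarrow> bit vec \<Rightarrow> bit vec" where
  "polar_encode n u = transpose_mat (kronecker_power polar_kernel n) *\<^sub>v u"

definition output_fixed :: "nat \<Rightarrow> nat set \<Rightarrow> nat \<Rightarrow> bool" where
  "output_fixed n S j \<longleftrightarrow>
     (\<forall>u \<in> carrier_vec (2 ^ n). (\<forall>i\<in>S. u $ i = 0) \<longrightarrow> polar_encode n u $ j = 0)"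

definition fixed_outputs :: "nat \<Rightarrow> nat set \<Rightarrow> nat set" where
  "fixed_outputs n S = {j \<in> {..<2 ^ n}. output_fixed n S j}"

definition shortened_polar_code :: "nat \<Rightarrow> nat set \<Rightarrow> nat set \<Rightarrow> bool" where
  "shortened_polar_code n U X \<longleftrightarrow>
     U \<subseteq> {..<2 ^ n} \<and> X = fixed_outputs n U \<and> card X = card U"

definition binary_dominated :: "nat \<Rightarrow> nat \<Rightarrow> nat \<Rightarrow> bool" where
  "binary_dominated n i j \<longleftrightarrow> (\<forall>t<n. bit i t \<longrightarrow> bit j t)"

definition strict_dominators :: "nat \<Rightarrow> nat \<Rightarrow> nat set" where
  "strict_dominators n j = {k \<in> {..<2 ^ n}. binary_dominated n j k \<and> j \<noteq> k}"

end

theory Submission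
  imports Defs
begin

text \<open>The \<open>(i, j)\<close> entry of the encoding matrix is \<open>1\<close> exactly when \<open>j\<close> is dominated by \<open>i\<close>, so
  \<open>x\<^sub>j\<close> is the sum of the \<open>u\<^sub>i\<close> over all dominators \<open>i\<close> of \<open>j\<close>, and it is fixed iff all of them are
  shortened. In particular every fixed output index is a shortened input index; equality of
  cardinalities makes the two sets equal. As \<open>j\<close> dominates itself and is not shortened, the only
  single additional input bit that can fix \<open>x\<^sub>j\<close> is \<open>u\<^sub>j\<close>.\<close>

lemma dim_polar_kernel [simp]:
  "dim_row polar_kernel = 2" "dim_col polar_kernel = 2"
  by (simp_all add: polar_kernel_def mat_of_rows_list_def)

text \<open>Domination of a single digit, phrased by parity so that it matches the top-digit
  condition in \<open>binary_dominated_Suc\<close>.\<close>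

lemma polar_kernel_index:
  assumes "a < 2" "b < 2"
  shows "polar_kernel $$ (a, b) = (if odd b \<longrightarrow> odd a then 1 else 0)"
  using assms by (auto simp: polar_kernel_def mat_of_rows_list_def less_2_cases_iff)

lemma dim_kronecker_power [simp]:
  "dim_row (kronecker_power A n) = dim_row A ^ n"
  "dim_col (kronecker_power A n) = dim_col A ^ n"
  by (induction n) (simp_all add: kronecker_def)

lemma binary_dominated_refl [simp]: "binary_dominated n i i"
  by (simp add: binary_dominated_def)

text \<open>The top digit is split off because \<open>kronecker_power\<close> adds each new kernel
  factor on the left, where it is indexed by the quotients by \<open>2 ^ n\<close>.\<close>

lemma binary_dominated_Suc:
  "binary_dominated (Suc n) i j \<longleftrightarrow>
     (odd (i div 2 ^ n) \<longrightarrow> odd (j div 2 ^ n)) \<and> binary_dominated n (i mod 2 ^ n) (j mod 2 ^ n)"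
  unfolding binary_dominated_def
  by (auto simp: less_Suc_eq bit_iff_odd[of _ n] take_bit_eq_mod[symmetric] bit_take_bit_iff)

text \<open>Kronecker products multiply entries, and a product of 0/1 indicators is the indicator of
  the conjunction of the digit conditions.\<close>

lemma kronecker_power_polar_kernel_index:
  assumes "i < 2 ^ n" "j < 2 ^ n"
  shows "kronecker_power polar_kernel n $$ (i, j) = (if binary_dominated n j i then 1 else 0)"
  using assms
proof (induction n arbitrary: i j)
  case 0
  then show ?case by (simp add: binary_dominated_def)
next
  case (Suc n)
  have "i div 2 ^ n < 2" "j div 2 ^ n < 2"
    using Suc.prems by (simp_all add: less_mult_imp_div_less)
  then show ?case
    using Suc.prems
    by (simp add: kronecker_def polar_kernel_index Suc.IH binary_dominated_Suc)
qed

lemma polar_encode_index: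
  assumes "u \<in> carrier_vec (2 ^ n)" "j < 2 ^ n"
  shows "polar_encode n u $ j = (\<Sum>i | i < 2 ^ n \<and> binary_dominated n j i. u $ i)"
proof -
  have "polar_encode n u $ j =
      (\<Sum>i\<in>{0..<2 ^ n}. if binary_dominated n j i then u $ i else 0)"
    unfolding polar_encode_def
    using assms
    by (subst index_mult_mat_vec; simp only: scalar_prod_def carrier_vecD)
      (auto simp: kronecker_power_polar_kernel_index simp del: sum_of_bool_eq intro!: sum.cong)
  also have "\<dots> = (\<Sum>i | i \<in> {0..<2 ^ n} \<and> binary_dominated n j i. u $ i)"
    by (rule sum.inter_filter[symmetric]) simp
  finally show ?thesis by simp
qed

lemma output_fixed_iff:
  assumes "S \<subseteq> {..<2 ^ n}" "j < 2 ^ n"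
  shows "output_fixed n S j \<longleftrightarrow> (\<forall>i<2 ^ n. binary_dominated n j i \<longrightarrow> i \<in> S)"
proof (intro iffI allI impI)
  fix i assume fixed: "output_fixed n S j" and i: "i < 2 ^ n" "binary_dominated n j i"
  show "i \<in> S"
  proof (rule ccontr)
    assume "i \<notin> S"
    \<comment> \<open>The unit vector at \<open>i\<close> respects the shortening of
      \<open>S\<close>, yet gives output 1 at \<open>j\<close>.\<close>
    define u :: "bit vec" where "u = vec (2 ^ n) (\<lambda>k. if k = i then 1 else 0)"
    have "polar_encode n u $ j = (\<Sum>k | k < 2 ^ n \<and> binary_dominated n j k. if k = i then 1 else 0)"
      using assms by (subst polar_encode_index) (auto simp: u_def intro!: sum.cong)
    also have "\<dots> = 1" using i by (simp add: sum.delta)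
    finally have "polar_encode n u $ j = 1" .
    \<comment> \<open>For \<open>k\<close> in \<open>S\<close>, the definition of \<open>u\<close>
      determines \<open>u $ k\<close> because \<open>k < 2 ^ n\<close>.\<close>
    moreover have "u \<in> carrier_vec (2 ^ n)" "\<forall>k\<in>S. u $ k = 0"
      using \<open>S \<subseteq> {..<2 ^ n}\<close> \<open>i \<notin> S\<close> by (auto simp: u_def)
    ultimately show False
      using fixed by (auto simp: output_fixed_def)
  qed
next
  assume "\<forall>i<2 ^ n. binary_dominated n j i \<longrightarrow> i \<in> S"
  then show "output_fixed n S j"
    using assms by (auto simp: output_fixed_def polar_encode_index intro!: sum.neutral)
qed

lemma shortened_polar_code_eq:
  assumes "shortened_polar_code n U X"
  shows "X = U"
proof (rule card_subset_eq)
  show "finite U"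
    using assms by (auto simp: shortened_polar_code_def intro: finite_subset)
  \<comment> \<open>The criterion is used at the index itself, by reflexivity of domination.\<close>
  show "X \<subseteq> U"
    using assms by (auto simp: shortened_polar_code_def fixed_outputs_def output_fixed_iff)
  show "card X = card U"
    using assms by (auto simp: shortened_polar_code_def)
qed

theorem theorem19:
  fixes n j :: nat and Us Xs :: "nat set"
  assumes "n \<ge> 1"
    and "shortened_polar_code n Us Xs"
    and "j \<in> {..<2 ^ n} - Xs"
  shows "(\<exists>k \<in> {..<2 ^ n} - Us. output_fixed n (insert k Us) j) \<longleftrightarrow> strict_dominators n j \<subseteq> Xs"
proof -
  have "Xs = Us" using assms(2) by (rule shortened_polar_code_eq)
  have j: "j < 2 ^ n" "j \<notin> Us" using assms(3) \<open>Xs = Us\<close> by auto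
  have "Us \<subseteq> {..<2 ^ n}" using assms(2) by (simp add: shortened_polar_code_def)
  \<comment> \<open>The bound on \<open>k\<close> keeps \<open>insert k Us\<close> inside the index
    range, as \<open>output_fixed_iff\<close> requires.\<close>
  then have "output_fixed n (insert k Us) j \<longleftrightarrow>
      (\<forall>i<2 ^ n. binary_dominated n j i \<longrightarrow> i \<in> insert k Us)" if "k < 2 ^ n" for k
    using that j by (intro output_fixed_iff) auto
  then have "(\<exists>k \<in> {..<2 ^ n} - Us. output_fixed n (insert k Us) j) \<longleftrightarrow>
      (\<exists>k \<in> {..<2 ^ n} - Us. \<forall>i<2 ^ n. binary_dominated n j i \<longrightarrow> i \<in> insert k Us)"
    by auto
  also have "\<dots> \<longleftrightarrow> strict_dominators n j \<subseteq> Us"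
  proof
    assume "\<exists>k \<in> {..<2 ^ n} - Us. \<forall>i<2 ^ n. binary_dominated n j i \<longrightarrow> i \<in> insert k Us"
    then obtain k where k: "\<forall>i<2 ^ n. binary_dominated n j i \<longrightarrow> i \<in> insert k Us"
      by blast
    \<comment> \<open>Taking \<open>i = j\<close> puts \<open>j\<close> into
      \<open>insert k Us\<close>, but \<open>j\<close> is not in \<open>Us\<close>.\<close>
    then have "k = j" using j by auto
    with k show "strict_dominators n j \<subseteq> Us"
      by (auto simp: strict_dominators_def)
  next
    assume "strict_dominators n j \<subseteq> Us"
    then have "\<forall>i<2 ^ n. binary_dominated n j i \<longrightarrow> i \<in> insert j Us"
      by (auto simp: strict_dominators_def)
    then show "\<exists>k \<in> {..<2 ^ n} - Us. \<forall>i<2 ^ n. binary_dominated n j i \<longrightarrow> i \<in> insert k Us"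
      using j by blast
  qed
  finally show ?thesis using \<open>Xs = Us\<close> by simp
qed

end
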